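(* There are constants $c$ and $n_0$ such that for all $n\ge n_0$, all integers $h\ge0$ and every surface $S$ of Euler genus $h$, the number of $n$-vertex simple maps in $S$ is at most $c^{n+h}h^h$.
   Context: A map is a connected pseudograph (loops and multiple edges allowed) cellularly embedded in a surface, considered as an unlabelled, unrooted object (up to isomorphism of embedded graphs). A map is simple if its underlying pseudograph is a simple graph, and $n$-vertex if it has $n$ vertices. Convention $0^0=1$. *)

theory Defs
  imports Complex_Main
begin

text \<open>Maps are encoded combinatorially by flags (graph-encoded maps):
  a finite flag set {..<N} with three fixed-point-free involutions r0, r1, r2
  such that r0 r2 = r2 r0 is fixed-point-free, acting transitively.
  Vertices, edges and faces are the orbits of the groups generated by
  {r1,r2}, {r0,r2}, {r0,r1}. This covers all maps with at least one edge.\<close>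

type_synonym fmap = "nat \<times> (nat \<Rightarrow> nat) \<times> (nat \<Rightarrow> nat) \<times> (nat \<Rightarrow> nat)"

definition step_rel :: "nat \<Rightarrow> (nat \<Rightarrow> nat) list \<Rightarrow> nat rel" where
  "step_rel N rs = {(x, r x) | x r. x < N \<and> r \<in> set rs}"

definition orbits :: "nat \<Rightarrow> (nat \<Rightarrow> nat) list \<Rightarrow> nat set set" where
  "orbits N rs = {..<N} // ((step_rel N rs)\<^sup>*)"

definition fpf_invol :: "nat \<Rightarrow> (nat \<Rightarrow> nat) \<Rightarrow> bool" where
  "fpf_invol N r \<longleftrightarrow> (\<forall>x<N. r x < N \<and> r (r x) = x \<and> r x \<noteq> x) \<and> (\<forall>x\<ge>N. r x = x)"

fun is_map :: "fmap \<Rightarrow> bool" where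
  "is_map (N, r0, r1, r2) \<longleftrightarrow>
     N > 0 \<and> fpf_invol N r0 \<and> fpf_invol N r1 \<and> fpf_invol N r2 \<and>
     (\<forall>x<N. r0 (r2 x) = r2 (r0 x) \<and> r0 (r2 x) \<noteq> x) \<and>
     (\<forall>x<N. \<forall>y<N. (x, y) \<in> (step_rel N [r0, r1, r2])\<^sup>*)"

fun vertices :: "fmap \<Rightarrow> nat set set" where
  "vertices (N, r0, r1, r2) = orbits N [r1, r2]"

fun edges :: "fmap \<Rightarrow> nat set set" where
  "edges (N, r0, r1, r2) = orbits N [r0, r2]"

fun faces :: "fmap \<Rightarrow> nat set set" where
  "faces (N, r0, r1, r2) = orbits N [r0, r1]"

text \<open>The vertex containing flag x.\<close>
fun vert_of :: "fmap \<Rightarrow> nat \<Rightarrow> nat set" where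
  "vert_of (N, r0, r1, r2) x = (step_rel N [r1, r2])\<^sup>* `` {x}"

text \<open>Set of end vertices of an edge.\<close>
definition ends :: "fmap \<Rightarrow> nat set \<Rightarrow> nat set set" where
  "ends M e = vert_of M ` e"

text \<open>Underlying graph simple: no loops and no multiple edges.\<close>
definition simple_map :: "fmap \<Rightarrow> bool" where
  "simple_map M \<longleftrightarrow> (\<forall>e\<in>edges M. card (ends M e) = 2) \<and>
     (\<forall>e\<in>edges M. \<forall>e'\<in>edges M. ends M e = ends M e' \<longrightarrow> e = e')"

text \<open>Orientable iff the flag graph is bipartite.\<close>
fun orientable :: "fmap \<Rightarrow> bool" where
  "orientable (N, r0, r1, r2) \<longleftrightarrow>
     (\<exists>\<sigma> :: nat \<Rightarrow> bool. \<forall>x<N. \<forall>r\<in>{r0, r1, r2}. \<sigma> (r x) \<noteq> \<sigma> x)"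

definition euler_genus :: "fmap \<Rightarrow> int" where
  "euler_genus M = 2 - (int (card (vertices M)) - int (card (edges M)) + int (card (faces M)))"

fun map_iso :: "fmap \<Rightarrow> fmap \<Rightarrow> bool" where
  "map_iso (N, r0, r1, r2) (N', s0, s1, s2) \<longleftrightarrow> N = N' \<and>
     (\<exists>\<phi>. bij_betw \<phi> {..<N} {..<N} \<and>
        (\<forall>x<N. \<phi> (r0 x) = s0 (\<phi> x) \<and> \<phi> (r1 x) = s1 (\<phi> x) \<and> \<phi> (r2 x) = s2 (\<phi> x)))"

text \<open>A (closed) surface is determined by orientability and Euler genus h:
  orientable surfaces have even Euler genus; non-orientable ones have h \<ge> 1.\<close>
definition is_surface :: "bool \<Rightarrow> nat \<Rightarrow> bool" where
  "is_surface orient h \<longleftrightarrow> (orient \<longrightarrow> even h) \<and> (\<not> orient \<longrightarrow> h \<ge> 1)"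

definition simple_maps_in :: "nat \<Rightarrow> bool \<Rightarrow> nat \<Rightarrow> fmap set" where
  "simple_maps_in n orient h = {M. is_map M \<and> simple_map M \<and> card (vertices M) = n \<and>
      orientable M = orient \<and> euler_genus M = int h}"

text \<open>Number of n-vertex simple maps in the surface (orient, h), up to isomorphism.\<close>
definition num_simple_maps :: "nat \<Rightarrow> bool \<Rightarrow> nat \<Rightarrow> nat" where
  "num_simple_maps n orient h =
     card (simple_maps_in n orient h // {(M, M'). map_iso M M'})"

end

theory Submission
  imports Defs
begin

text \<open>
  Grow a spanning tree \<open>T\<close> from the vertex of flag 0. Walking around \<open>T\<close>, that is, applying
  alternately \<open>r1\<close> and the involution that is \<open>r0\<close> on \<open>T\<close> and \<open>r2\<close> off \<open>T\<close>, visits all flags in one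
  cycle, and along this tour \<open>r2\<close> matches the flags of \<open>T\<close> like nested brackets. Dually, grow a
  spanning tree \<open>D\<close> of the dual map that avoids \<open>T\<close>; along its tour \<open>r0\<close> matches the flags of \<open>D\<close> like
  nested brackets. By Euler's formula exactly \<open>h\<close> edges remain. Hence the map can be recovered
  from a word over a fixed alphabet, which records along the tour of \<open>T\<close> the type of each flag and its
  bracket, together with one of the at most \<open>h ^ h\<close> ways of gluing the two sides of the remaining
  edges: first \<open>r1\<close> and \<open>r2\<close> are determined, then \<open>r0\<close> off \<open>D\<close>, which suffices to perform the
  tour of \<open>D\<close>, and finally \<open>r0\<close> on \<open>D\<close>. A simple map with at least three vertices has no faces
  of length less than three, so the word has length at most \<open>12 (n + h)\<close>.
\<close>

section \<open>Nested matchings\<close>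

inductive nested :: "('a \<Rightarrow> 'a) \<Rightarrow> 'a set \<Rightarrow> 'a list \<Rightarrow> bool" for m Op where
  Nil: "nested m Op []"
| insert: "nested m Op (A @ B) \<Longrightarrow> x \<in> Op \<Longrightarrow> m x \<notin> Op \<Longrightarrow> nested m Op (A @ [x, m x] @ B)"

lemma nested_remove:
  assumes "nested m Op (A @ x # z # B)" "x \<in> Op" "z \<notin> Op"
  shows "z = m x \<and> nested m Op (A @ B)"
  using assms
proof (induction "A @ x # z # B" arbitrary: A B rule: nested.induct)
  case Nil
  then show ?case by simp
next
  case (insert C D c A B)
  consider "C = A" "c = x" "m c = z" "D = B"
    | "c = z" | "m c = x"
    | C2 where "C = A @ x # z # C2" "B = C2 @ [c, m c] @ D"
    | A2 where "A = C @ [c, m c] @ A2" "D = A2 @ x # z # B"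
  proof -
    from insert.hyps(5) obtain us where
      "C = A @ us \<and> us @ [c, m c] @ D = x # z # B \<or> C @ us = A \<and> [c, m c] @ D = us @ x # z # B"
      by (auto simp: append_eq_append_conv2)
    then show thesis
      by (cases us; cases "tl us") (auto intro: that)
  qed
  then show ?case
  proof cases
    case (4 C2)
    then have "z = m x \<and> nested m Op (A @ C2 @ D)"
      using insert.hyps(2)[of A "C2 @ D"] insert.prems by simp
    then show ?thesis
      using nested.insert[of m Op "A @ C2" D c] insert.hyps(3,4) 4 by simp
  next
    case (5 A2)
    then have "z = m x \<and> nested m Op (C @ A2 @ B)"
      using insert.hyps(2)[of "C @ A2" B] insert.prems by simp
    then show ?thesis
      using nested.insert[of m Op C "A2 @ B" c] insert.hyps(3,4) 5 by simp
  qed (use insert in auto)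
qed

lemma nested_unique:
  assumes "nested m Op xs" "nested m' Op' (map f xs)"
    and "\<forall>x\<in>set xs. f x \<in> Op' \<longleftrightarrow> x \<in> Op" "x \<in> set xs" "x \<in> Op"
  shows "f (m x) = m' (f x)"
  using assms
proof (induction arbitrary: x rule: nested.induct)
  case Nil
  then show ?case by simp
next
  case (insert A B y)
  have "f (m y) = m' (f y) \<and> nested m' Op' (map f A @ map f B)"
    using insert.prems insert.hyps by (intro nested_remove) auto
  moreover have "x \<noteq> m y" using insert by auto
  ultimately show ?case
    using insert.prems insert.IH[of x] by auto
qed

section \<open>Tours\<close>

primrec flat :: "('a \<times> 'a) list \<Rightarrow> 'a list" where
  "flat [] = []"
| "flat (a # ls) = fst a # snd a # flat ls"

lemma flat_append [simp]: "flat (xs @ ys) = flat xs @ flat ys"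
  by (induction xs) auto

lemma set_flat: "set (flat ls) = fst ` set ls \<union> snd ` set ls"
  by (induction ls) auto

lemma length_flat: "length (flat ls) = 2 * length ls"
  by (induction ls) auto

lemma flat_inject: "flat xs = flat ys \<longleftrightarrow> xs = ys"
proof (induction xs arbitrary: ys)
  case Nil
  show ?case by (cases ys) auto
next
  case (Cons a xs)
  then show ?case by (cases ys) (auto simp: prod_eq_iff)
qed

lemma flat_map: "flat (map (map_prod f f) ls) = map f (flat ls)"
  by (induction ls) auto

abbreviation linked :: "('a \<Rightarrow> 'a) \<Rightarrow> ('a \<times> 'a) list \<Rightarrow> bool" where
  "linked p \<equiv> successively (\<lambda>a b. fst b = p (snd a))"

text \<open>A cyclic walk that applies \<open>w\<close> inside each pair of the list and \<open>p\<close> from one pair to the next.\<close>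

definition tour :: "('a \<Rightarrow> 'a) \<Rightarrow> ('a \<Rightarrow> 'a) \<Rightarrow> ('a \<times> 'a) list \<Rightarrow> bool" where
  "tour w p ls \<longleftrightarrow> ls \<noteq> [] \<and> distinct (flat ls) \<and> (\<forall>a\<in>set ls. snd a = w (fst a)) \<and>
     linked p ls \<and> fst (hd ls) = p (snd (last ls))"

lemma tourD:
  assumes "tour w p ls"
  shows "ls \<noteq> []" "distinct (flat ls)" "a \<in> set ls \<Longrightarrow> snd a = w (fst a)"
    "linked p ls" "fst (hd ls) = p (snd (last ls))"
  using assms by (auto simp: tour_def)

text \<open>Adding an edge between two tours splices the second one into the first.\<close>

lemma tour_insert:
  assumes T: "tour w p (ys @ (x, x') # zs)" and O: "tour u p ((y', y) # os)"
    and disj: "set (flat (ys @ (x, x') # zs)) \<inter> set (flat ((y', y) # os)) = {}"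
    and w1: "w' x = y" "w' y' = x'"
    and w2: "\<And>a. a \<in> set (flat (ys @ zs)) \<Longrightarrow> w' a = w a" "\<And>a. a \<in> set (flat os) \<Longrightarrow> w' a = u a"
  shows "tour w' p (ys @ (x, y) # os @ (y', x') # zs)"
proof -
  have 1: "linked p (ys @ (x, y) # os @ (y', x') # zs)"
  proof -
    have "linked p (ys @ (x, x') # zs)" "linked p ((y', y) # os)"
      and y': "y' = p (snd (last ((y', y) # os)))"
      using tourD(4)[OF T] tourD(4)[OF O] tourD(5)[OF O] unfolding list.sel fst_conv by blast+
    then have l: "linked p ys" "linked p zs" "linked p os"
      "ys \<noteq> [] \<longrightarrow> x = p (snd (last ys))" "zs \<noteq> [] \<longrightarrow> fst (hd zs) = p x'"
      "os \<noteq> [] \<longrightarrow> fst (hd os) = p y"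
      by (auto simp: successively_append_iff successively_Cons simp del: last.simps)
    have y'': "os \<noteq> [] \<longrightarrow> y' = p (snd (last os))" "os = [] \<longrightarrow> y' = p y"
      using y' by (auto split: if_splits)
    have "linked p ((y', x') # zs)"
      unfolding successively_Cons using l(2,5) by auto
    moreover have "linked p ((x, y) # os)"
      unfolding successively_Cons using l(3,6) by auto
    moreover have "snd (last ((x, y) # os)) = (if os = [] then y else snd (last os))" by simp
    ultimately have *: "linked p (((x, y) # os) @ (y', x') # zs)"
      unfolding successively_append_iff using y'' by (cases "os = []") (metis fst_conv list.sel(1))+
    define R where "R = ((x, y) # os) @ (y', x') # zs"
    have "linked p (ys @ R)"
      unfolding successively_append_iff[of _ ys] using l(1,4) * by (auto simp: R_def)
    then show ?thesis by (simp add: R_def)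
  qed
  have 2: "distinct (flat (ys @ (x, y) # os @ (y', x') # zs))"
    using tourD(2)[OF T] tourD(2)[OF O] disj by auto
  have "snd a = w' (fst a)" if a: "a \<in> set (ys @ (x, y) # os @ (y', x') # zs)" for a
  proof -
    consider "a \<in> set (ys @ zs)" | "a \<in> set os" | "a = (x, y)" | "a = (y', x')"
      using a by auto
    then show ?thesis
    proof cases
      case 1
      then show ?thesis using tourD(3)[OF T, of a] w2(1)[of "fst a"] by (auto simp: set_flat)
    next
      case 2
      then show ?thesis using tourD(3)[OF O, of a] w2(2)[of "fst a"] by (auto simp: set_flat)
    qed (use w1 in auto)
  qed
  moreover have "fst (hd (ys @ (x, y) # os @ (y', x') # zs)) =
      p (snd (last (ys @ (x, y) # os @ (y', x') # zs)))"
    using tourD(5)[OF T] by (cases ys; cases zs) auto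
  ultimately show ?thesis
    using 1 2 unfolding tour_def by auto
qed

lemma tour_equivariant:
  assumes "tour w p ls" "tour w' p' (map (map_prod f f) ls)"
    and inv: "\<And>x. x \<in> set (flat ls) \<Longrightarrow> w (w x) = x \<and> p (p x) = x"
    and inv': "\<And>x. x \<in> set (flat ls) \<Longrightarrow> w' (w' (f x)) = f x \<and> p' (p' (f x)) = f x"
    and x: "x \<in> set (flat ls)"
  shows "f (w x) = w' (f x)" "f (p x) = p' (f x)"
proof -
  have w1: "f (w (fst a)) = w' (f (fst a))" if "a \<in> set ls" for a
    using assms(1,2) that unfolding tour_def by (metis (no_types, lifting) fst_map_prod imageI list.set_map snd_map_prod)
  have w2: "f (w (snd a)) = w' (f (snd a))" if "a \<in> set ls" for a
  proof -
    have s: "snd a = w (fst a)" and m: "fst a \<in> set (flat ls)"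
      using assms(1) that by (auto simp: tour_def set_flat)
    show ?thesis using w1[OF that] inv[OF m] inv'[OF m] unfolding s by simp
  qed
  show "f (w x) = w' (f x)" using x w1 w2 by (auto simp: set_flat)
  define n where "n = length ls"
  have n: "n > 0" using assms(1) by (auto simp: tour_def n_def)
  have nx: "fst (ls ! (Suc i mod n)) = p (snd (ls ! i)) \<and> f (fst (ls ! (Suc i mod n))) = p' (f (snd (ls ! i)))"
    if "i < n" for i
  proof (cases "Suc i = n")
    case True
    then have "i = length ls - 1" by (simp add: n_def)
    then have "last ls = ls ! i" "hd ls = ls ! 0" using n
      by (simp_all add: n_def last_conv_nth hd_conv_nth)
    then show ?thesis using assms(1,2) True
      by (auto simp: tour_def last_map hd_map)
  next
    case False
    then have i: "Suc i < n" using that by simp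
    then show ?thesis using assms(1,2)
      by (auto simp: tour_def successively_conv_nth n_def)
  qed
  have p1: "f (p (snd a)) = p' (f (snd a))" if "a \<in> set ls" for a
    using that nx by (metis in_set_conv_nth n_def)
  have p2: "f (p (fst a)) = p' (f (fst a))" if a: "a \<in> set ls" for a
  proof -
    obtain i where i: "i < n" "a = ls ! i" using a by (auto simp: in_set_conv_nth n_def)
    obtain j where j: "j < n" "i = Suc j mod n"
    proof (cases i)
      case 0
      then show ?thesis using that[of "n - 1"] n by auto
    next
      case (Suc j)
      then show ?thesis using that[of j] i by auto
    qed
    have m: "snd (ls ! j) \<in> set (flat ls)" using j by (auto simp: set_flat n_def)
    have "fst a = p (snd (ls ! j))" "f (fst a) = p' (f (snd (ls ! j)))"
      using nx[OF j(1)] i j by auto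
    then show ?thesis using inv[OF m] inv'[OF m] by simp
  qed
  show "f (p x) = p' (f x)" using x p1 p2 by (auto simp: set_flat)
qed

lemma tour_determined:
  assumes T: "tour w p ls" and T': "tour w' p' ls'" "length ls = length ls'"
    and h: "f (fst (hd ls)) = fst (hd ls')"
    and c: "\<And>x. x \<in> set (flat ls) \<Longrightarrow> f (w x) = w' (f x) \<and> f (p x) = p' (f x)"
  shows "ls' = map (map_prod f f) ls"
proof -
  have s: "snd (ls' ! i) = f (snd (ls ! i))" if "i < length ls" "fst (ls' ! i) = f (fst (ls ! i))" for i
  proof -
    have "snd (ls ! i) = w (fst (ls ! i))" "snd (ls' ! i) = w' (fst (ls' ! i))"
      using T T' that by (auto simp: tour_def)
    then show ?thesis using that c[of "fst (ls ! i)"] by (auto simp: set_flat)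
  qed
  have "ls' ! i = map_prod f f (ls ! i)" if "i < length ls" for i
    using that
  proof (induction i)
    case 0
    then have "fst (ls' ! 0) = f (fst (ls ! 0))"
      using h T T' by (auto simp: tour_def hd_conv_nth)
    then show ?case using s[OF 0] by (auto simp: prod_eq_iff)
  next
    case (Suc i)
    then have "ls' ! i = map_prod f f (ls ! i)" by simp
    moreover have "fst (ls' ! Suc i) = p' (snd (ls' ! i))" "fst (ls ! Suc i) = p (snd (ls ! i))"
      using T T' Suc.prems by (auto simp: tour_def successively_conv_nth)
    ultimately have "fst (ls' ! Suc i) = f (fst (ls ! Suc i))"
      using c[of "snd (ls ! i)"] Suc.prems by (auto simp: set_flat)
    then show ?case using s[OF Suc.prems] by (auto simp: prod_eq_iff)
  qed
  then show ?thesis using T'(2) by (auto intro: nth_equalityI)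
qed

section \<open>Growing a tree\<close>

lemma step_rel_sym:
  assumes "\<And>r. r \<in> set rs \<Longrightarrow> fpf_invol N r"
  shows "sym (step_rel N rs)"
  using assms unfolding sym_def step_rel_def fpf_invol_def by auto metis

lemma step_rel_equiv:
  assumes "\<And>r. r \<in> set rs \<Longrightarrow> fpf_invol N r"
  shows "equiv UNIV ((step_rel N rs)\<^sup>*)"
  using step_rel_sym[OF assms] by (intro equivI) (auto simp: sym_rtrancl refl_rtrancl trans_rtrancl)

lemma reach_closed:
  assumes "(x, y) \<in> (step_rel N rs)\<^sup>*" "x \<in> Y" "\<And>r z. r \<in> set rs \<Longrightarrow> z \<in> Y \<Longrightarrow> r z \<in> Y"
  shows "y \<in> Y"
  using assms(1,2) by induction (auto simp: step_rel_def assms(3))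

lemma reach_less:
  assumes "\<And>r. r \<in> set rs \<Longrightarrow> fpf_invol N r" "x < N" "(x, y) \<in> (step_rel N rs)\<^sup>*"
  shows "y < N"
  using reach_closed[OF assms(3), of "{..<N}"] assms(1,2) by (auto simp: fpf_invol_def)

lemma reach_step:
  assumes "(x, y) \<in> (step_rel N rs)\<^sup>*" "y < N" "r \<in> set rs"
  shows "(x, r y) \<in> (step_rel N rs)\<^sup>*"
  using assms by (auto simp: step_rel_def intro: rtrancl_into_rtrancl)

lemma Union_orbits:
  assumes "\<And>r. r \<in> set rs \<Longrightarrow> fpf_invol N r"
  shows "\<Union>(orbits N rs) = {..<N}"
  using reach_less[OF assms] by (auto simp: orbits_def quotient_def)

lemma orbits_disjoint:
  assumes "\<And>r. r \<in> set rs \<Longrightarrow> fpf_invol N r" "a \<in> orbits N rs" "b \<in> orbits N rs" "a \<inter> b \<noteq> {}"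
  shows "a = b"
proof -
  have "a \<in> UNIV // (step_rel N rs)\<^sup>*" "b \<in> UNIV // (step_rel N rs)\<^sup>*"
    using assms by (auto simp: orbits_def quotient_def)
  then show ?thesis using quotient_disj[OF step_rel_equiv[OF assms(1)]] assms(4) by blast
qed

lemma orbit_tour:
  assumes p: "fpf_invol N p" and u: "fpf_invol N u" and y: "y < N"
  shows "\<exists>ls. tour u p ls \<and> fst (hd ls) = y \<and> set (flat ls) = (step_rel N [p, u])\<^sup>* `` {y}"
proof -
  let ?E = "(step_rel N [p, u])\<^sup>*"
  define P where "P ls \<longleftrightarrow> ls \<noteq> [] \<and> distinct (flat ls) \<and> (\<forall>a\<in>set ls. snd a = u (fst a)) \<and>
     linked p ls \<and> fst (hd ls) = y \<and> set (flat ls) \<subseteq> ?E `` {y}" for ls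
  have lt: "z < N" if "(y, z) \<in> ?E" for z
    using reach_less[OF _ y that] p u by auto
  have P0: "P [(y, u y)]"
    using p u y reach_step[of y y N "[p,u]" u] by (auto simp: P_def fpf_invol_def)
  have bd: "length ls < Suc N" if "P ls" for ls
  proof -
    have "card (set (flat ls)) \<le> card {..<N}"
      using that lt by (intro card_mono) (auto simp: P_def)
    then show ?thesis using that by (simp add: P_def distinct_card length_flat)
  qed
  \<comment> \<open>a longest walk without repetitions can only stop at its start\<close>
  obtain ls where ls: "P ls" and mx: "\<And>l. P l \<Longrightarrow> length l \<le> length ls"
    using ex_has_greatest_nat[of P, OF P0, of length "Suc N"] bd by (metis less_imp_le)
  note D = ls[unfolded P_def]
  have el: "a < N" if "a \<in> set (flat ls)" for a using D that lt by auto
  define z where "z = p (snd (last ls))"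
  have sl: "snd (last ls) \<in> set (flat ls)" using D by (auto simp: set_flat)
  have zE: "(y, z) \<in> ?E" unfolding z_def
    using D sl el reach_step[of y "snd (last ls)" N "[p,u]" p] by auto
  then have zN: "z < N" using lt by simp
  have cu: "u a \<in> set (flat ls)" if "a \<in> set (flat ls)" for a
    using that D u el by (auto simp: set_flat fpf_invol_def image_iff)
  have zin: "z \<in> set (flat ls)"
  proof (rule ccontr)
    assume n: "z \<notin> set (flat ls)"
    then have "u z \<notin> set (flat ls)" using cu[of "u z"] u zN by (auto simp: fpf_invol_def)
    moreover have "u z \<noteq> z" using u zN by (auto simp: fpf_invol_def)
    moreover have "(y, u z) \<in> ?E" using zE zN reach_step[of y z N "[p,u]" u] by auto
    ultimately have "P (ls @ [(z, u z)])"
      using D n zE by (auto simp: P_def successively_append_iff z_def)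
    then show False using mx by fastforce
  qed
  define n where "n = length ls"
  have n: "n > 0" using D by (auto simp: n_def)
  have lastn: "last ls = ls ! (n - 1)" using D by (auto simp: n_def last_conv_nth)
  have nx: "fst (ls ! Suc i) = p (snd (ls ! i))" if "Suc i < n" for i
    using D that by (auto simp: successively_conv_nth n_def)
  have pp: "p (p a) = a \<and> p a \<noteq> a" if "a \<in> set (flat ls)" for a
    using el[OF that] p by (auto simp: fpf_invol_def)
  have mem: "fst (ls ! i) \<in> set (flat ls)" "snd (ls ! i) \<in> set (flat ls)" if "i < n" for i
    using that by (auto simp: set_flat n_def)
  have inj: "fst (ls ! i) \<noteq> snd (ls ! j) \<and> (snd (ls ! i) = snd (ls ! j) \<longrightarrow> i = j)"
    if "i < n" "j < n" for i j
  proof -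
    have *: "flat l ! (2*i) = fst (l ! i) \<and> flat l ! (2*i+1) = snd (l ! i)" if "i < length l" for i and l :: "(nat \<times> nat) list"
      using that by (induction l arbitrary: i) (auto simp: nth_Cons split: nat.splits)
    have d: "distinct (flat ls)" using D by simp
    show ?thesis
      using *[of i ls] *[of j ls] that nth_eq_iff_index_eq[OF d, of "2*i" "2*j+1"]
        nth_eq_iff_index_eq[OF d, of "2*i+1" "2*j+1"]
      by (auto simp: n_def length_flat)
  qed
  have zh: "z = fst (hd ls)"
  proof -
    from zin obtain i where i: "i < n" "z = fst (ls ! i) \<or> z = snd (ls ! i)"
      by (auto simp: set_flat in_set_conv_nth n_def)
    show ?thesis
    proof (cases "z = fst (ls ! i)")
      case True
      show ?thesis
      proof (cases i)
        case 0
        then show ?thesis using True D by (auto simp: hd_conv_nth)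
      next
        case (Suc j)
        then have "p (snd (last ls)) = p (snd (ls ! j))" using True nx[of j] i by (simp add: z_def)
        then have "snd (last ls) = snd (ls ! j)" using pp sl mem[of j] i Suc by (metis Suc_lessD)
        then show ?thesis using inj[of "n - 1" j] i Suc n lastn by auto
      qed
    next
      case False
      then have zs: "z = snd (ls ! i)" using i by simp
      show ?thesis
      proof (cases "Suc i < n")
        case True
        then have "fst (ls ! Suc i) = snd (last ls)" using nx[of i] zs pp[OF sl] by (simp add: z_def)
        then show ?thesis using inj[of "Suc i" "n - 1"] True lastn by auto
      next
        case F: False
        then have "i = n - 1" using i by simp
        then have "z = snd (last ls)" using zs lastn by simp
        then show ?thesis using pp[OF sl] by (simp add: z_def)
      qed
    qed
  qed
  have cp: "p a \<in> set (flat ls)" if a: "a \<in> set (flat ls)" for a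
  proof -
    from a obtain i where i: "i < n" "a = fst (ls ! i) \<or> a = snd (ls ! i)"
      by (auto simp: set_flat in_set_conv_nth n_def)
    then consider "a = fst (ls ! 0)" | j where "i = Suc j" "a = fst (ls ! Suc j)" | "a = snd (ls ! i)"
      by (cases i) auto
    then show ?thesis
    proof cases
      case 1
      then have "a = p (snd (last ls))" using zh D by (auto simp: z_def hd_conv_nth)
      then show ?thesis using sl pp[OF sl] by simp
    next
      case (2 j)
      then have "p a = snd (ls ! j)" using nx[of j] i mem(2)[of j] pp by auto
      then show ?thesis using mem(2)[of j] 2 i by auto
    next
      case 3
      show ?thesis
      proof (cases "Suc i < n")
        case True
        then show ?thesis using nx[of i] 3 mem(1)[of "Suc i"] by simp
      next
        case False
        then have "i = n - 1" using i by simp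
        then have "p a = z" using 3 lastn by (simp add: z_def)
        then show ?thesis using zin by simp
      qed
    qed
  qed
  have "?E `` {y} \<subseteq> set (flat ls)"
  proof
    fix b assume "b \<in> ?E `` {y}"
    then have b: "(y, b) \<in> ?E" by simp
    have "y \<in> set (flat ls)" using D by (auto simp: set_flat)
    then show "b \<in> set (flat ls)"
      using reach_closed[OF b, of "set (flat ls)"] cu cp by auto
  qed
  then have "set (flat ls) = ?E `` {y}" using D by auto
  moreover have "tour u p ls" using D zh by (auto simp: tour_def z_def)
  ultimately show ?thesis using D by auto
qed

lemma nested_cong:
  assumes "nested m Op xs" "\<forall>x\<in>set xs. x \<in> Op' \<longleftrightarrow> x \<in> Op"
  shows "nested m Op' xs"
  using assms by induction (auto intro: nested.Nil nested.insert[simplified])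

text \<open>
  With \<open>(p, u, v) = (r1, r2, r0)\<close> this grows a spanning tree of the map; with \<open>(r1, r0, r2)\<close>, a
  spanning tree of the dual map. \<open>U\<close> is the set of flags of the edges that may be used.
\<close>

locale tree_growth =
  fixes N :: nat and p u v :: "nat \<Rightarrow> nat" and U :: "nat set" and \<rho> :: nat
  assumes p: "fpf_invol N p" and u: "fpf_invol N u" and v: "fpf_invol N v"
    and comm: "x < N \<Longrightarrow> u (v x) = v (u x)" and uv: "x < N \<Longrightarrow> u (v x) \<noteq> x"
    and U: "U \<subseteq> {..<N}" and Ucl: "x \<in> U \<Longrightarrow> u x \<in> U \<and> v x \<in> U"
    and trans: "Y \<subseteq> {..<N} \<Longrightarrow> Y \<noteq> {} \<Longrightarrow> (\<And>x. x \<in> Y \<Longrightarrow> p x \<in> Y \<and> u x \<in> Y) \<Longrightarrow>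
      (\<And>x. x \<in> Y \<Longrightarrow> x \<in> U \<Longrightarrow> v x \<in> Y) \<Longrightarrow> Y = {..<N}"
    and \<rho>: "\<rho> < N"
begin

abbreviation E :: "nat rel" where "E \<equiv> (step_rel N [p, u])\<^sup>*"

definition grown :: "(nat \<times> nat) list \<Rightarrow> nat set \<Rightarrow> nat set \<Rightarrow> nat set set \<Rightarrow> bool" where
  "grown ls S Op C \<longleftrightarrow> tour (\<lambda>x. if x \<in> S then v x else u x) p ls \<and> fst (hd ls) = \<rho> \<and>
     C \<subseteq> orbits N [p, u] \<and> set (flat ls) = \<Union>C \<and>
     S \<subseteq> U \<and> S \<subseteq> \<Union>C \<and> (\<forall>x\<in>S. u x \<in> S \<and> v x \<in> S) \<and>
     Op \<subseteq> S \<and> (\<forall>x\<in>S. x \<in> Op \<or> u x \<in> Op) \<and>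
     nested u Op (filter (\<lambda>x. x \<in> S) (flat ls)) \<and> card S + 4 = 4 * card C"

lemma grownD:
  assumes "grown ls S Op C"
  shows "tour (\<lambda>x. if x \<in> S then v x else u x) p ls" "fst (hd ls) = \<rho>"
    "C \<subseteq> orbits N [p, u]" "set (flat ls) = \<Union>C" "S \<subseteq> U" "S \<subseteq> \<Union>C"
    "x \<in> S \<Longrightarrow> u x \<in> S" "x \<in> S \<Longrightarrow> v x \<in> S" "Op \<subseteq> S" "x \<in> S \<Longrightarrow> x \<in> Op \<or> u x \<in> Op"
    "nested u Op (filter (\<lambda>x. x \<in> S) (flat ls))" "card S + 4 = 4 * card C"
  using assms unfolding grown_def by blast+

lemma invols:
  assumes "x < N"
  shows "p x < N" "p (p x) = x" "p x \<noteq> x" "u x < N" "u (u x) = x" "u x \<noteq> x"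
    "v x < N" "v (v x) = x" "v x \<noteq> x" "u x \<noteq> v x"
  using assms p u v uv unfolding fpf_invol_def by metis+

lemma fpf_list: "r \<in> set [p, u] \<Longrightarrow> fpf_invol N r"
  using p u by auto

lemma finite_orbits: "finite (orbits N [p, u])"
  by (auto simp: orbits_def quotient_def)

lemma grown_step:
  assumes g: "grown ls S Op C" and ne: "set (flat ls) \<noteq> {..<N}"
  shows "\<exists>ls' S' Op' C'. grown ls' S' Op' C' \<and> length ls < length ls'"
proof -
  note D = grownD[OF g]
  define Y where "Y = set (flat ls)"
  have YC: "Y = \<Union>C" using D(4) by (simp add: Y_def)
  have YN: "Y \<subseteq> {..<N}" using D(3) Union_orbits[OF fpf_list] unfolding YC by blast
  have Ycl: "p a \<in> Y \<and> u a \<in> Y" if a: "a \<in> Y" for a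
  proof -
    obtain c where c: "c \<in> C" "a \<in> c" using a YC by auto
    then obtain b where b: "c = E `` {b}" using D(3) by (auto simp: orbits_def quotient_def)
    have "p a \<in> c" "u a \<in> c"
      using c b a YN reach_step[of b a N "[p,u]" p] reach_step[of b a N "[p,u]" u] by auto
    then show ?thesis using c YC by auto
  qed
  have "Y \<noteq> {}" using tourD(1)[OF D(1)] by (cases ls) (auto simp: Y_def)
  then obtain x0 where x0: "x0 \<in> Y" "x0 \<in> U" "v x0 \<notin> Y"
    using trans[OF YN] Ycl ne Y_def by blast
  have SY: "S \<subseteq> Y" using D(6) YC by simp
  have x0S: "x0 \<notin> S" using x0 D(8) SY by blast
  obtain x where x: "(x, u x) \<in> set ls" "x \<in> U" "v x \<notin> Y"
  proof -
    obtain a where a: "a \<in> set ls" "x0 = fst a \<or> x0 = snd a"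
      using x0(1) by (auto simp: Y_def set_flat)
    show thesis
    proof (cases "x0 = fst a")
      case True
      then have "snd a = u x0" using tourD(3)[OF D(1) a(1)] x0S by simp
      then show ?thesis using that[of x0] a True x0 by (metis prod.collapse)
    next
      case False
      then have s: "snd a = x0" using a by simp
      have fN: "fst a < N" using a(1) YN by (auto simp: Y_def set_flat)
      have "fst a \<notin> S" using tourD(3)[OF D(1) a(1)] x0S s D(8) by metis
      then have "x0 = u (fst a)" using tourD(3)[OF D(1) a(1)] s by simp
      then have f: "fst a = u x0" "x0 = u (u x0)" using invols(5)[OF fN] by auto
      then have "(u x0, u (u x0)) \<in> set ls" using a(1) s by (metis prod.collapse)
      moreover have "v (u x0) \<notin> Y"
      proof
        assume "v (u x0) \<in> Y"
        moreover have "x0 < N" using x0 YN by auto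
        ultimately have "u (v x0) \<in> Y" using comm by simp
        then have "u (u (v x0)) \<in> Y" using Ycl by blast
        then show False using x0(3) invols(5)[OF invols(7)[OF \<open>x0 < N\<close>]] by simp
      qed
      ultimately show ?thesis using that[of "u x0"] Ucl x0 by blast
    qed
  qed
  have xY: "x \<in> Y" "u x \<in> Y" using x(1) by (force simp: Y_def set_flat)+
  have xN: "x < N" using xY YN by auto
  have xS: "x \<notin> S" using x D(8) SY by blast
  have uxS: "u x \<notin> S" using xS D(7) invols(5)[OF xN] by metis
  define y where "y = v x"
  have yN: "y < N" and yY: "y \<notin> Y" using x xN invols by (auto simp: y_def)
  have uyY: "u y \<notin> Y" using Ycl[of "u y"] yY invols(5)[OF yN] by auto
  have vuy: "v (u y) = u x" using comm[OF yN] invols(8)[OF xN] by (simp add: y_def)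
  have vy: "v y = x" using invols(8)[OF xN] by (simp add: y_def)
  have vux: "v (u x) = u y" using comm[OF xN] by (simp add: y_def)
  obtain ys zs where ls: "ls = ys @ (x, u x) # zs" using x(1) by (meson split_list)
  obtain os0 where os0: "tour u p os0" "fst (hd os0) = u y" "set (flat os0) = E `` {u y}"
    using orbit_tour[OF p u, of "u y"] invols(4)[OF yN] by auto
  obtain os where os: "os0 = (u y, y) # os"
  proof -
    have "snd (hd os0) = u (u y)" using tourD(3)[OF os0(1), of "hd os0"] tourD(1)[OF os0(1)] os0(2) by simp
    then show thesis using that tourD(1)[OF os0(1)] os0(2) invols(5)[OF yN]
      by (cases os0) (auto simp: prod_eq_iff)
  qed
  define Q where "Q = E `` {u y}"
  have flQ: "set (flat os0) = Q" using os0(3) by (simp add: Q_def)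
  have QY: "Y \<inter> Q = {}"
  proof (rule ccontr)
    assume "Y \<inter> Q \<noteq> {}"
    then obtain b where b: "b \<in> Y" "(u y, b) \<in> E" by (auto simp: Q_def)
    then have "(b, u y) \<in> E" using step_rel_equiv[of "[p,u]" N, OF fpf_list]
      by (auto elim!: equivE dest: symD)
    then have "u y \<in> Y" using reach_closed[of b "u y" N "[p,u]" Y] b Ycl by auto
    then show False using uyY by simp
  qed
  have QinQ: "Q \<in> orbits N [p, u]" using invols(4)[OF yN]
    by (auto simp: Q_def orbits_def intro: quotientI)
  define S' where "S' = S \<union> {x, u x, y, u y}"
  define Op' where "Op' = Op \<union> {x, y}"
  define C' where "C' = insert Q C"
  define ls' where "ls' = ys @ (x, y) # os @ (u y, u x) # zs"
  have yQ: "y \<in> Q" "u y \<in> Q" using flQ os by auto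
  have dls: "distinct (flat ls)" "distinct (flat os0)" using tourD(2) D(1) os0(1) by auto
  have ysY: "set (flat ys) \<subseteq> Y - {x, u x}" "set (flat zs) \<subseteq> Y - {x, u x}"
    using dls(1) by (auto simp: Y_def ls)
  have osQ: "set (flat os) \<subseteq> Q - {y, u y}" using dls(2) flQ os by auto
  have S'ys: "a \<in> S' \<longleftrightarrow> a \<in> S" if "a \<in> set (flat ys) \<union> set (flat zs)" for a
    using that ysY yY uyY by (auto simp: S'_def)
  have S'os: "a \<notin> S'" if "a \<in> set (flat os)" for a
    using that osQ QY SY xY by (auto simp: S'_def)
  have "tour (\<lambda>x. if x \<in> S' then v x else u x) p ls'"
    unfolding ls'_def
  proof (rule tour_insert[OF D(1)[unfolded ls] os0(1)[unfolded os]])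
    show "set (flat (ys @ (x, u x) # zs)) \<inter> set (flat ((u y, y) # os)) = {}"
      using QY unfolding Y_def flQ[symmetric] ls os by blast
  qed (use S'ys S'os vuy in \<open>auto simp: S'_def y_def\<close>)
  moreover have "fst (hd ls') = \<rho>" using D(2) by (cases ys) (auto simp: ls ls'_def)
  moreover have "C' \<subseteq> orbits N [p, u]" using D(3) QinQ by (auto simp: C'_def)
  moreover have "set (flat ls') = \<Union>C'"
  proof -
    have "set (flat ls') = set (flat ls) \<union> set (flat os0)" by (auto simp: ls'_def ls os)
    then show ?thesis using YC flQ by (auto simp: C'_def Y_def)
  qed
  moreover have "S' \<subseteq> U" using D(5) x Ucl by (auto simp: S'_def y_def)
  moreover have "S' \<subseteq> \<Union>C'"
    using SY xY yQ unfolding S'_def C'_def YC by auto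
  moreover have "\<forall>x\<in>S'. u x \<in> S' \<and> v x \<in> S'"
    using D(7,8) invols(5)[OF xN] invols(5)[OF yN] vuy vy vux by (auto simp: S'_def y_def)
  moreover have "Op' \<subseteq> S'" using D(9) by (auto simp: Op'_def S'_def)
  moreover have "\<forall>x\<in>S'. x \<in> Op' \<or> u x \<in> Op'"
    using D(10) invols(5)[OF xN] invols(5)[OF yN] by (auto simp: S'_def Op'_def)
  moreover have "nested u Op' (filter (\<lambda>x. x \<in> S') (flat ls'))"
  proof -
    let ?A = "filter (\<lambda>x. x \<in> S) (flat ys)" and ?B = "filter (\<lambda>x. x \<in> S) (flat zs)"
    have "filter (\<lambda>x. x \<in> S) (flat ls) = ?A @ ?B" using xS uxS by (simp add: ls)
    then have "nested u Op (?A @ ?B)" using D(11) by simp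
    then have "nested u Op' (?A @ ?B)"
      using xS yY SY by (elim nested_cong) (auto simp: Op'_def)
    then have "nested u Op' (?A @ [x, u x] @ ?B)"
      using uxS D(9) invols(6,10)[OF xN] by (intro nested.insert) (auto simp: Op'_def y_def)
    then have "nested u Op' ((?A @ [x]) @ [y, u y] @ ([u x] @ ?B))"
      using uyY SY xY D(9) invols(6)[OF yN] by (intro nested.insert) (auto simp: Op'_def)
    moreover have "filter (\<lambda>x. x \<in> S') (flat ys) = ?A" "filter (\<lambda>x. x \<in> S') (flat zs) = ?B"
      using S'ys by (auto intro: filter_cong)
    moreover have "filter (\<lambda>x. x \<in> S') (flat os) = []" using S'os by (auto simp: filter_empty_conv)
    ultimately show ?thesis by (simp add: ls'_def S'_def)
  qed
  moreover have "card S' + 4 = 4 * card C'"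
  proof -
    have "finite S" "finite C" using SY YN D(3) finite_orbits by (auto intro: finite_subset)
    moreover have "Q \<notin> C" using yQ yY YC by auto
    moreover have "card S' = card S + card {x, u x, y, u y}"
      unfolding S'_def using \<open>finite S\<close> xS uxS SY yY uyY by (intro card_Un_disjoint) auto
    moreover have "card {x, u x, y, u y} = 4"
    proof -
      have "x \<noteq> y" "x \<noteq> u y" "u x \<noteq> y" "u x \<noteq> u y" using xY yY uyY by auto
      then show ?thesis using invols(6)[OF xN] invols(6)[OF yN] by simp
    qed
    ultimately show ?thesis using D(12) by (simp add: C'_def)
  qed
  ultimately have "grown ls' S' Op' C'" unfolding grown_def by blast
  moreover have "length ls < length ls'" by (simp add: ls ls'_def)
  ultimately show ?thesis by blast
qed

lemma spanning_tour:
  obtains S ls Op where "tour (\<lambda>x. if x \<in> S then v x else u x) p ls" "fst (hd ls) = \<rho>"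
    "set (flat ls) = {..<N}" "S \<subseteq> U" "\<forall>x\<in>S. u x \<in> S" "\<forall>x\<in>S. v x \<in> S"
    "\<forall>x\<in>S. x \<in> Op \<or> u x \<in> Op"
    "nested u Op (filter (\<lambda>x. x \<in> S) (flat ls))" "card S + 4 = 4 * card (orbits N [p, u])"
proof -
  obtain ls0 where ls0: "tour u p ls0" "fst (hd ls0) = \<rho>" "set (flat ls0) = E `` {\<rho>}"
    using orbit_tour[OF p u \<rho>] by auto
  define P where "P ls \<longleftrightarrow> (\<exists>S Op C. grown ls S Op C)" for ls
  have "grown ls0 {} {} {E `` {\<rho>}}"
    using ls0 \<rho> by (auto simp: grown_def orbits_def intro: quotientI nested.Nil)
  then have P0: "P ls0" by (auto simp: P_def)
  have bd: "length ls \<le> N" if P: "P ls" for ls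
  proof -
    obtain S Op C where g: "grown ls S Op C" using P unfolding P_def by blast
    have "card (set (flat ls)) \<le> card {..<N}"
      using grownD(3,4)[OF g] Union_orbits[of "[p, u]" N, OF fpf_list] by (intro card_mono) blast+
    then show ?thesis using distinct_card[OF tourD(2)[OF grownD(1)[OF g]]] by (simp add: length_flat)
  qed
  obtain ls where ls: "P ls" and mx: "\<And>l. P l \<Longrightarrow> length l \<le> length ls"
    using ex_has_greatest_nat[of P, OF P0, of length "Suc N"] bd by (metis less_Suc_eq_le)
  obtain S Op C where g: "grown ls S Op C" using ls unfolding P_def by blast
  have X: "set (flat ls) = {..<N}"
    using grown_step[OF g] mx unfolding P_def by (metis not_less)
  have "orbits N [p, u] \<subseteq> C"
  proof
    fix b assume b: "b \<in> orbits N [p, u]"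
    then obtain a where "a < N" "a \<in> b" by (auto simp: orbits_def quotient_def)
    then obtain c where "c \<in> C" "a \<in> c" using X grownD(4)[OF g] by auto
    then show "b \<in> C" using orbits_disjoint[of "[p, u]" N b c, OF fpf_list] b \<open>a \<in> b\<close> grownD(3)[OF g] by blast
  qed
  then have "C = orbits N [p, u]" using grownD(3)[OF g] by auto
  then show thesis using that[of S ls Op] grownD[OF g] X by blast
qed

end

lemma sum_card_orbits:
  assumes "\<And>r. r \<in> set rs \<Longrightarrow> fpf_invol N r"
  shows "(\<Sum>a\<in>orbits N rs. card a) = N"
proof -
  have U: "\<Union>(orbits N rs) = {..<N}" using Union_orbits[OF assms] .
  have "card (\<Union>(orbits N rs)) = (\<Sum>a\<in>orbits N rs. card a)"
  proof (rule card_Union_disjoint)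
    show "pairwise disjnt (orbits N rs)"
      using orbits_disjoint[OF assms] by (auto simp: pairwise_def disjnt_def)
    show "finite a" if "a \<in> orbits N rs" for a
      using that U by (metis Union_upper finite_lessThan finite_subset)
  qed
  then show ?thesis using U by simp
qed

lemma tour_invariant:
  assumes "tour w p ls" "\<And>x. x \<in> set (flat ls) \<Longrightarrow> (w x \<in> Y \<longleftrightarrow> x \<in> Y) \<and> (p x \<in> Y \<longleftrightarrow> x \<in> Y)"
    and "x \<in> set (flat ls)" "y \<in> set (flat ls)" "x \<in> Y"
  shows "y \<in> Y"
proof -
  have "\<forall>a\<in>set l. (fst a \<in> Y \<longleftrightarrow> fst (hd l) \<in> Y) \<and> (snd a \<in> Y \<longleftrightarrow> fst (hd l) \<in> Y)"
    if "linked p l" "\<forall>a\<in>set l. snd a = w (fst a)"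
      "\<forall>x\<in>set (flat l). (w x \<in> Y \<longleftrightarrow> x \<in> Y) \<and> (p x \<in> Y \<longleftrightarrow> x \<in> Y)" for l
    using that
  proof (induction l)
    case Nil
    then show ?case by simp
  next
    case (Cons b l)
    then show ?case by (cases l) auto
  qed
  from this[of ls] have "\<forall>z\<in>set (flat ls). z \<in> Y \<longleftrightarrow> fst (hd ls) \<in> Y"
    using tourD(3,4)[OF assms(1)] assms(2) unfolding set_flat by blast
  then show ?thesis using assms(3-5) by blast
qed

section \<open>Maps and their number of flags\<close>

locale gem =
  fixes N :: nat and r0 r1 r2 :: "nat \<Rightarrow> nat"
  assumes is_map: "is_map (N, r0, r1, r2)"
begin

lemma fpf: "fpf_invol N r0" "fpf_invol N r1" "fpf_invol N r2"
  using is_map by auto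

lemma inv [simp]:
  assumes "x < N"
  shows "r0 x < N" "r0 (r0 x) = x" "r0 x \<noteq> x" "r1 x < N" "r1 (r1 x) = x" "r1 x \<noteq> x"
    "r2 x < N" "r2 (r2 x) = x" "r2 x \<noteq> x"
  using assms fpf unfolding fpf_invol_def by metis+

lemma comm:
  assumes "x < N" shows "r0 (r2 x) = r2 (r0 x)" "r0 (r2 x) \<noteq> x"
  using assms is_map by auto

lemma pos: "0 < N" using is_map by auto

lemma edge_orbit:
  assumes x: "x < N"
  shows "(step_rel N [r0, r2])\<^sup>* `` {x} = {x, r0 x, r2 x, r0 (r2 x)}"
proof -
  let ?E = "(step_rel N [r0, r2])\<^sup>*"
  have "(x, r0 x) \<in> ?E" "(x, r2 x) \<in> ?E"
    using reach_step[of x x N "[r0, r2]"] x by auto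
  moreover from this have "(x, r0 (r2 x)) \<in> ?E"
    using reach_step[of x "r2 x" N "[r0, r2]" r0] x by auto
  moreover have "y \<in> {x, r0 x, r2 x, r0 (r2 x)}" if "(x, y) \<in> ?E" for y
    using that by (rule reach_closed) (use x comm(1)[OF x] comm(1)[of "r0 x"] in auto)
  ultimately show ?thesis by auto
qed

lemma edges_card: "N = 4 * card (edges (N, r0, r1, r2))"
proof -
  have "card a = 4" if "a \<in> orbits N [r0, r2]" for a
  proof -
    obtain x where x: "x < N" "a = (step_rel N [r0, r2])\<^sup>* `` {x}"
      using \<open>a \<in> _\<close> by (auto simp: orbits_def quotient_def)
    have "a = {x, r0 x, r2 x, r0 (r2 x)}"
      using edge_orbit[OF x(1)] x(2) by simp
    moreover have "r0 x \<noteq> r2 x" using comm(2)[OF x(1)] x by (metis inv(2) inv(8))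
    moreover have "r0 x \<noteq> r0 (r2 x)" using x by (metis inv(2,7,9))
    moreover have "r2 x \<noteq> r0 (r2 x)" using x by (metis inv(3,7))
    moreover have "x \<noteq> r0 x" "x \<noteq> r2 x" "x \<noteq> r0 (r2 x)"
      using inv(3,9)[OF x(1)] comm(2)[OF x(1)] by metis+
    ultimately show ?thesis by simp
  qed
  then have "(\<Sum>a\<in>orbits N [r0, r2]. card a) = 4 * card (orbits N [r0, r2])"
    by simp
  then show ?thesis using sum_card_orbits[of "[r0, r2]" N] fpf by (metis edges.simps empty_iff empty_set insert_iff list.set(2))
qed

end

locale simple_gem = gem +
  assumes simple: "simple_map (N, r0, r1, r2)" and three: "3 \<le> card (vertices (N, r0, r1, r2))"
begin

definition V :: "nat \<Rightarrow> nat set" where "V x = (step_rel N [r1, r2])\<^sup>* `` {x}"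

lemma V_step:
  assumes "x < N" shows "V (r1 x) = V x" "V (r2 x) = V x"
proof -
  have e: "equiv UNIV ((step_rel N [r1, r2])\<^sup>*)" using fpf by (intro step_rel_equiv) auto
  have "(x, r1 x) \<in> (step_rel N [r1, r2])\<^sup>*" "(x, r2 x) \<in> (step_rel N [r1, r2])\<^sup>*"
    using reach_step[of x x N "[r1, r2]"] assms by auto
  then show "V (r1 x) = V x" "V (r2 x) = V x"
    using equiv_class_eq[OF e] unfolding V_def by metis+
qed

lemma ends_edge:
  assumes x: "x < N"
  shows "ends (N, r0, r1, r2) {x, r0 x, r2 x, r0 (r2 x)} = {V x, V (r0 x)}"
    "{x, r0 x, r2 x, r0 (r2 x)} \<in> edges (N, r0, r1, r2)"
proof -
  have "V (r0 (r2 x)) = V (r0 x)" using comm(1)[OF x] V_step(2)[of "r0 x"] x by simp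
  then show "ends (N, r0, r1, r2) {x, r0 x, r2 x, r0 (r2 x)} = {V x, V (r0 x)}"
    using V_step[OF x] by (auto simp: ends_def V_def[symmetric])
  show "{x, r0 x, r2 x, r0 (r2 x)} \<in> edges (N, r0, r1, r2)"
    using x edge_orbit[OF x] by (auto simp: orbits_def intro!: quotientI simp flip: edge_orbit)
qed

lemma no_loop:
  assumes x: "x < N" shows "V (r0 x) \<noteq> V x"
proof
  assume "V (r0 x) = V x"
  then have "card (ends (N, r0, r1, r2) {x, r0 x, r2 x, r0 (r2 x)}) = 1" using ends_edge(1)[OF x] by simp
  then show False using simple ends_edge(2)[OF x] by (auto simp: simple_map_def)
qed

lemma no_digon:
  assumes x: "x < N" shows "r0 (r1 x) \<noteq> r1 (r0 x)"
proof
  assume d: "r0 (r1 x) = r1 (r0 x)"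
  define y where "y = r1 x"
  have y: "y < N" using x by (simp add: y_def)
  have "V y = V x" "V (r0 y) = V (r0 x)"
    using d V_step(1)[of x] V_step(1)[of "r0 x"] x by (auto simp: y_def)
  then have "{x, r0 x, r2 x, r0 (r2 x)} = {y, r0 y, r2 y, r0 (r2 y)}"
    using ends_edge[OF x] ends_edge[OF y] simple unfolding simple_map_def by metis
  then have "y \<in> {x, r0 x, r2 x, r0 (r2 x)}" by simp
  moreover have "y \<noteq> x" using x by (simp add: y_def)
  moreover have "y \<noteq> r0 x" using no_loop[OF x] \<open>V y = V x\<close> by auto
  moreover have "y \<noteq> r0 (r2 x)"
    using no_loop[of "r2 x"] \<open>V y = V x\<close> V_step[OF x] x by auto
  ultimately have y2: "r1 x = r2 x" by (simp add: y_def)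
  let ?Z = "{x, r0 x, r2 x, r0 (r2 x)}"
  have r1: "r1 (r0 x) = r0 (r2 x)" "r1 (r2 x) = x"
    using d y2 x by (metis, metis inv(5))
  then have "r1 (r0 (r2 x)) = r0 x" using x by (metis inv(1,5))
  then have cl: "r z \<in> ?Z" if "z \<in> ?Z" "r \<in> set [r0, r1, r2]" for r z
    using that x r1 y2 comm(1)[OF x] comm(1)[of "r0 x"] by auto
  have "z \<in> ?Z" if "z < N" for z
  proof (rule reach_closed)
    show "(x, z) \<in> (step_rel N [r0, r1, r2])\<^sup>*" using is_map x that by auto
  qed (use cl in auto)
  then have "V z \<in> {V x, V (r0 x)}" if "z < N" for z
    using V_step[OF x] V_step(2)[of "r0 x"] comm(1)[OF x] x that by fastforce
  then have "vertices (N, r0, r1, r2) \<subseteq> {V x, V (r0 x)}"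
    by (auto simp: orbits_def quotient_def V_def)
  then have "card (vertices (N, r0, r1, r2)) \<le> card {V x, V (r0 x)}" by (intro card_mono) auto
  also have "\<dots> \<le> 2" by (metis card_2_iff card_insert_le_m1 card.empty card.insert finite.emptyI finite.insertI insert_absorb2 le_refl no_loop x)
  finally show False using three by simp
qed

lemma faces_card: "6 * card (faces (N, r0, r1, r2)) \<le> N"
proof -
  have "6 \<le> card a" if "a \<in> orbits N [r0, r1]" for a
  proof -
    let ?E = "(step_rel N [r0, r1])\<^sup>*"
    obtain x where x: "x < N" "a = ?E `` {x}"
      using \<open>a \<in> _\<close> by (auto simp: orbits_def quotient_def)
    have st: "(x, r0 z) \<in> ?E \<and> (x, r1 z) \<in> ?E" if "(x, z) \<in> ?E" "z < N" for z
      using reach_step[OF that] by auto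
    let ?F = "[x, r0 x, r1 x, r0 (r1 x), r1 (r0 x), r1 (r0 (r1 x))]"
    have "set ?F \<subseteq> a" unfolding x(2) using st x(1) by auto
    moreover have "distinct ?F"
    proof -
      have a: "r0 x \<noteq> r1 x" using no_loop[OF x(1)] V_step(1)[OF x(1)] by metis
      have b: "r0 (r1 x) \<noteq> r1 (r0 x)" using no_digon[OF x(1)] .
      have 1: "x \<noteq> r0 (r1 x)" "x \<noteq> r1 (r0 x)"
        using a x(1) by (metis inv(2,4), metis inv(1,5))
      have 2: "x \<noteq> r1 (r0 (r1 x))" using x(1) by (metis inv(1,3,4,5))
      have 3: "r0 x \<noteq> r0 (r1 x)" "r0 x \<noteq> r1 (r0 x)"
        using x(1) by (metis inv(2,4,6), metis inv(1,6))
      have 4: "r0 x \<noteq> r1 (r0 (r1 x))" using b x(1) by (metis inv(1,4,5))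
      have 5: "r1 x \<noteq> r0 (r1 x)" "r1 x \<noteq> r1 (r0 x)" "r1 x \<noteq> r1 (r0 (r1 x))"
        using x(1) 1 by (metis inv(3,4), metis inv(1,3,5), metis inv(1,4,5))
      have 6: "r0 (r1 x) \<noteq> r1 (r0 (r1 x))" "r1 (r0 x) \<noteq> r1 (r0 (r1 x))"
        using x(1) 3 by (metis inv(1,4,6), metis inv(1,4,5))
      have 7: "x \<noteq> r0 x" "x \<noteq> r1 x" using x(1) by (metis inv(3), metis inv(6))
      show ?thesis using a b 1 2 3 4 5 6 7 by simp
    qed
    moreover have "finite a"
    proof (rule finite_subset)
      show "a \<subseteq> {..<N}" unfolding x(2) using reach_less[of "[r0, r1]" N x] fpf x(1) by auto
    qed simp
    ultimately have "card (set ?F) \<le> card a" by (intro card_mono)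
    then show ?thesis using distinct_card[OF \<open>distinct ?F\<close>] by simp
  qed
  then have "(\<Sum>a\<in>orbits N [r0, r1]. 6) \<le> (\<Sum>a\<in>orbits N [r0, r1]. card a)"
    by (intro sum_mono)
  then show ?thesis using sum_card_orbits[of "[r0, r1]" N] fpf
    by (simp add: mult.commute) (metis empty_iff insert_iff list.set(1,2))
qed

lemma flags_bound:
  assumes "card (vertices (N, r0, r1, r2)) = n" "euler_genus (N, r0, r1, r2) = int h"
  shows "N \<le> 12 * (n + h)"
proof -
  define e f where "e = card (edges (N, r0, r1, r2))" and "f = card (faces (N, r0, r1, r2))"
  have "int (n + h) = 2 + int e - int f"
    using assms unfolding euler_genus_def e_def f_def by simp
  moreover have "int N = 4 * int e" using edges_card unfolding e_def by linarith
  moreover have "6 * int f \<le> int N" using faces_card unfolding f_def by linarith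
  moreover have "3 * int f \<le> 2 * int e" using calculation by linarith
  ultimately have "int N \<le> int (12 * (n + h))" by simp
  then show ?thesis by linarith
qed

end

section \<open>Coding of maps\<close>

type_synonym label = "bool \<times> bool \<times> bool \<times> bool \<times> bool \<times> bool"

text \<open>
  \<open>OT\<close> and \<open>OD\<close> are the opening brackets of the two trees; \<open>A\<close> contains one flag of each edge
  outside both trees, and \<open>B\<close> is the image of \<open>A\<close> under \<open>r0\<close>, which \<open>ks\<close> describes by positions along
  the tour. The final \<open>None\<close>s make all code words equally long.
\<close>

locale coded_gem = gem +
  fixes lsT T OT lsD D OD A B and W :: "label option list" and k :: nat and ks :: "nat list"
  assumes tour_T: "tour (\<lambda>x. if x \<in> T then r0 x else r2 x) r1 lsT"
    and hdT: "fst (hd lsT) = 0" and setT: "set (flat lsT) = {..<N}"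
    and clT: "x \<in> T \<Longrightarrow> r0 x \<in> T" "x \<in> T \<Longrightarrow> r2 x \<in> T" and OT: "x \<in> T \<Longrightarrow> x \<in> OT \<or> r2 x \<in> OT"
    and nestedT: "nested r2 OT (filter (\<lambda>x. x \<in> T) (flat lsT))"
    and tour_D: "tour (\<lambda>x. if x \<in> D then r2 x else r0 x) r1 lsD"
    and hdD: "fst (hd lsD) = 0" and setD: "set (flat lsD) = {..<N}"
    and clD: "x \<in> D \<Longrightarrow> r0 x \<in> D" "x \<in> D \<Longrightarrow> r2 x \<in> D" and OD: "x \<in> D \<Longrightarrow> x \<in> OD \<or> r0 x \<in> OD"
    and nestedD: "nested r0 OD (filter (\<lambda>x. x \<in> D) (flat lsD))"
    and A: "x < N \<Longrightarrow> x \<notin> T \<Longrightarrow> x \<notin> D \<Longrightarrow> x \<in> A \<or> r0 x \<in> A \<or> r2 x \<in> A \<or> r0 (r2 x) \<in> A"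
    and ks: "map r0 (filter (\<lambda>x. x \<in> A) (flat lsT)) = map ((!) (filter (\<lambda>x. x \<in> B) (flat lsT))) ks"
      "set ks \<subseteq> {..<length (filter (\<lambda>x. x \<in> B) (flat lsT))}"
    and W: "W = map (\<lambda>x. Some (x \<in> T, x \<in> OT, x \<in> D, x \<in> OD, x \<in> A, x \<in> B)) (flat lsT) @
      replicate k None"

lemma ex_list_map:
  assumes "distinct xs" "length xs = length ys"
  obtains f where "map f xs = ys"
proof
  show "map (\<lambda>x. the (map_of (zip xs ys) x)) xs = ys"
    using assms by (intro nth_equalityI) (auto simp: map_of_zip_nth)
qed

lemma coded_gem_iso:
  assumes "coded_gem N r0 r1 r2 lsT T OT lsD D OD A B W k ks"
    and "coded_gem N' s0 s1 s2 lsT' T' OT' lsD' D' OD' A' B' W k' ks"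
  shows "map_iso (N, r0, r1, r2) (N', s0, s1, s2)"
proof -
  interpret M: coded_gem N r0 r1 r2 lsT T OT lsD D OD A B W k ks by fact
  interpret M': coded_gem N' s0 s1 s2 lsT' T' OT' lsD' D' OD' A' B' W k' ks by fact
  let ?xs = "flat lsT" and ?ys = "flat lsT'"
  let ?lab = "\<lambda>x. (x \<in> T, x \<in> OT, x \<in> D, x \<in> OD, x \<in> A, x \<in> B)"
  let ?lab' = "\<lambda>x. (x \<in> T', x \<in> OT', x \<in> D', x \<in> OD', x \<in> A', x \<in> B')"
  have "takeWhile (\<lambda>a. a \<noteq> None) W = map (\<lambda>x. Some (?lab x)) ?xs"
    unfolding M.W by (subst takeWhile_append2) (auto simp: takeWhile_eq_Nil_iff)
  moreover have "takeWhile (\<lambda>a. a \<noteq> None) W = map (\<lambda>x. Some (?lab' x)) ?ys"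
    unfolding M'.W by (subst takeWhile_append2) (auto simp: takeWhile_eq_Nil_iff)
  ultimately have labs: "map (\<lambda>x. Some (?lab x)) ?xs = map (\<lambda>x. Some (?lab' x)) ?ys" by simp
  then have len: "length ?xs = length ?ys" by (rule map_eq_imp_length_eq)
  have dx: "distinct ?xs" "distinct ?ys" using tourD(2)[OF M.tour_T] tourD(2)[OF M'.tour_T] .
  have lx: "length ?xs = N" "length ?ys = N'"
    using distinct_card[OF dx(1)] distinct_card[OF dx(2)] M.setT M'.setT by auto
  then have NN: "N' = N" using len by simp
  obtain f where f: "map f ?xs = ?ys" using ex_list_map[OF dx(1) len] .
  have f': "lsT' = map (map_prod f f) lsT" using f by (simp add: flat_map[symmetric] flat_inject)
  have flt: "f x < N" if "x < N" for x
  proof -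
    have "f x \<in> set (map f ?xs)" using that M.setT by auto
    then show ?thesis using f M'.setT NN by simp
  qed
  have bij: "bij_betw f {..<N} {..<N'}"
    using dx(2) M.setT M'.setT unfolding f[symmetric] by (auto simp: bij_betw_def distinct_map)
  have "Some (?lab x) = Some (?lab' (f x))" if "x < N" for x
    using labs that M.setT unfolding f[symmetric] by (auto simp del: option.inject prod.inject)
  then have lab: "x \<in> T \<longleftrightarrow> f x \<in> T'" "x \<in> OT \<longleftrightarrow> f x \<in> OT'" "x \<in> D \<longleftrightarrow> f x \<in> D'" "x \<in> OD \<longleftrightarrow> f x \<in> OD'"
    "x \<in> A \<longleftrightarrow> f x \<in> A'" "x \<in> B \<longleftrightarrow> f x \<in> B'" if "x < N" for x
    using that by simp_all
  have filt: "filter (\<lambda>y. y \<in> Z') (map f zs) = map f (filter (\<lambda>x. x \<in> Z) zs)"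
    if "set zs = {..<N}" "\<And>x. x < N \<Longrightarrow> x \<in> Z \<longleftrightarrow> f x \<in> Z'" for zs Z Z'
    using that unfolding filter_map by (auto intro!: arg_cong[of _ _ "map f"] filter_cong)
  define w where "w x = (if x \<in> T then r0 x else r2 x)" for x
  define w' where "w' y = (if y \<in> T' then s0 y else s2 y)" for y
  have tw: "tour w r1 lsT" "tour w' s1 (map (map_prod f f) lsT)"
    using M.tour_T M'.tour_T by (simp_all add: w_def[abs_def] w'_def[abs_def] f')
  have i1: "w (w x) = x \<and> r1 (r1 x) = x" if "x \<in> set (flat lsT)" for x
  proof -
    have "x < N" using that M.setT by simp
    then show ?thesis using M.clT[of x] M.clT(2)[of "r2 x"] by (auto simp: w_def)
  qed
  have i2: "w' (w' (f x)) = f x \<and> s1 (s1 (f x)) = f x" if "x \<in> set (flat lsT)" for x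
  proof -
    have "f x < N'" using flt[of x] that M.setT NN by simp
    then show ?thesis using M'.clT[of "f x"] M'.clT(2)[of "s2 (f x)"] by (auto simp: w'_def)
  qed
  have tour_comm: "f (w x) = w' (f x) \<and> f (r1 x) = s1 (f x)" if "x < N" for x
    using tour_equivariant[OF tw i1 i2, of x] that M.setT by simp
  have c1: "f (r1 x) = s1 (f x)" if "x < N" for x using tour_comm[OF that] by simp
  have c0T: "f (r0 x) = s0 (f x)" if "x < N" "x \<in> T" for x
    using tour_comm[OF that(1)] lab(1)[OF that(1)] that by (simp add: w_def w'_def)
  have c2H: "f (r2 x) = s2 (f x)" if "x < N" "x \<notin> T" for x
    using tour_comm[OF that(1)] lab(1)[OF that(1)] that by (simp add: w_def w'_def)
  have c2O: "f (r2 x) = s2 (f x)" if "x < N" "x \<in> T" "x \<in> OT" for x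
  proof (rule nested_unique[OF M.nestedT])
    show "nested s2 OT' (map f (filter (\<lambda>x. x \<in> T) (flat lsT)))"
      using M'.nestedT filt[OF M.setT lab(1)] unfolding f[symmetric] by simp
    show "\<forall>x\<in>set (filter (\<lambda>x. x \<in> T) (flat lsT)). (f x \<in> OT') = (x \<in> OT)"
      using lab(2) M.setT by auto
  qed (use that M.setT in auto)
  have c2: "f (r2 x) = s2 (f x)" if x: "x < N" for x
  proof (cases "x \<in> T \<and> x \<notin> OT")
    case True
    then have "f (r2 (r2 x)) = s2 (f (r2 x))" using c2O[of "r2 x"] M.OT[of x] M.clT[of x] x by auto
    then have "s2 (f x) = s2 (s2 (f (r2 x)))" using x by simp
    moreover have "f (r2 x) < N'" using flt[of "r2 x"] x NN by simp
    ultimately show ?thesis by simp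
  qed (use c2O c2H x in blast)
  have c0A: "f (r0 x) = s0 (f x)" if x: "x < N" "x \<in> A" for x
  proof -
    let ?FA = "filter (\<lambda>x. x \<in> A) ?xs" and ?FB = "filter (\<lambda>x. x \<in> B) ?xs"
    have "map s0 (map f ?FA) = map ((!) (map f ?FB)) ks"
      using M'.ks(1) filt[OF M.setT lab(5)] filt[OF M.setT lab(6)] unfolding f[symmetric] by simp
    also have "\<dots> = map f (map ((!) ?FB) ks)"
      using M.ks(2) by (auto simp: nth_map)
    also have "\<dots> = map f (map r0 ?FA)" using M.ks(1) by simp
    finally have "\<forall>x\<in>set ?FA. s0 (f x) = f (r0 x)" by simp
    then show ?thesis using x M.setT by auto
  qed
  have c00: "f (r0 x) = s0 (f x)" if "x < N" "f (r0 (r0 x)) = s0 (f (r0 x))" for x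
  proof -
    have "f (r0 x) < N'" using flt[of "r0 x"] that NN by simp
    then show ?thesis using that by (metis M.inv(2) M'.inv(2))
  qed
  have c02: "f (r0 x) = s0 (f x)" if x: "x < N" and e: "f (r0 (r2 x)) = s0 (f (r2 x))" for x
  proof -
    have y: "f x < N'" using flt[of x] x NN by simp
    have "s2 (f (r0 x)) = f (r2 (r0 x))" using c2[of "r0 x"] x by simp
    also have "\<dots> = s0 (s2 (f x))" using e M.comm(1)[OF x] c2[OF x] by simp
    also have "\<dots> = s2 (s0 (f x))" using M'.comm(1)[OF y] .
    finally have "s2 (s2 (f (r0 x))) = s2 (s2 (s0 (f x)))" by simp
    moreover have "f (r0 x) < N'" using flt[of "r0 x"] x NN by simp
    ultimately show ?thesis using y by simp
  qed
  have c0H: "f (r0 x) = s0 (f x)" if x: "x < N" "x \<notin> D" for x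
  proof (cases "x \<in> T")
    case False
    then consider "x \<in> A" | "r0 x \<in> A" | "r2 x \<in> A" | "r0 (r2 x) \<in> A" using M.A x by blast
    then show ?thesis
    proof cases
      case 2
      then show ?thesis using c00[of x] c0A[of "r0 x"] x by simp
    next
      case 3
      then show ?thesis using c02[of x] c0A[of "r2 x"] x by simp
    next
      case 4
      then show ?thesis using c02[of x] c00[of "r2 x"] c0A[of "r0 (r2 x)"] x by simp
    qed (use c0A x in simp)
  qed (use c0T x in simp)
  have "lsD' = map (map_prod f f) lsD"
  proof (rule tour_determined[OF M.tour_D M'.tour_D])
    have "length (flat lsD) = N" "length (flat lsD') = N'"
      using distinct_card[OF tourD(2)[OF M.tour_D]] distinct_card[OF tourD(2)[OF M'.tour_D]] M.setD M'.setD by auto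
    then show "length lsD = length lsD'" using NN by (simp add: length_flat)
    have "fst (hd lsT') = f (fst (hd lsT))"
      unfolding f' using tourD(1)[OF M.tour_T] by (simp add: hd_map)
    then show "f (fst (hd lsD)) = fst (hd lsD')" using M.hdT M.hdD M'.hdT M'.hdD by simp
    fix x assume "x \<in> set (flat lsD)"
    then have "x < N" using M.setD by simp
    then show "f (if x \<in> D then r2 x else r0 x) = (if f x \<in> D' then s2 (f x) else s0 (f x)) \<and> f (r1 x) = s1 (f x)"
      using lab(3) c2 c0H c1 by auto
  qed
  then have fD: "flat lsD' = map f (flat lsD)" by (simp add: flat_map)
  have c0O: "f (r0 x) = s0 (f x)" if "x < N" "x \<in> D" "x \<in> OD" for x
  proof (rule nested_unique[OF M.nestedD])
    show "nested s0 OD' (map f (filter (\<lambda>x. x \<in> D) (flat lsD)))"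
      using M'.nestedD filt[OF M.setD lab(3)] unfolding fD by simp
    show "\<forall>x\<in>set (filter (\<lambda>x. x \<in> D) (flat lsD)). (f x \<in> OD') = (x \<in> OD)"
      using lab(4) M.setD by auto
  qed (use that M.setD in auto)
  have c0: "f (r0 x) = s0 (f x)" if x: "x < N" for x
  proof (cases "x \<in> D \<and> x \<notin> OD")
    case True
    then show ?thesis using c00[of x] c0O[of "r0 x"] M.OD[of x] M.clD(1)[of x] x by auto
  qed (use c0O c0H x in blast)
  show ?thesis using bij c0 c1 c2 NN by auto
qed

lemma card_Un_image:
  assumes "finite G" "inj_on r G" "G \<inter> r ` G = {}"
  shows "card (G \<union> r ` G) = 2 * card G"
  using assms by (simp add: card_Un_disjoint card_image)

lemma (in gem) edge_transversal:
  assumes H: "H \<subseteq> {..<N}" "\<And>x. x \<in> H \<Longrightarrow> r0 x \<in> H \<and> r2 x \<in> H"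
  obtains A where "A \<subseteq> H" "4 * card A = card H"
    "\<And>x. x \<in> H \<Longrightarrow> x \<in> A \<or> r0 x \<in> A \<or> r2 x \<in> A \<or> r0 (r2 x) \<in> A"
proof -
  define A where "A = {x \<in> H. x < r0 x \<and> x < r2 x \<and> x < r0 (r2 x)}"
  define G where "G = A \<union> r0 ` A"
  have HN: "x < N" if "x \<in> H" for x using that H by auto
  have AH: "A \<subseteq> H" by (auto simp: A_def)
  have GH: "G \<subseteq> H" using AH H(2) by (auto simp: G_def)
  have cov: "x \<in> A \<or> r0 x \<in> A \<or> r2 x \<in> A \<or> r0 (r2 x) \<in> A" if x: "x \<in> H" for x
  proof -
    have xN: "x < N" using HN x .
    define m where "m = Min {x, r0 x, r2 x, r0 (r2 x)}"
    have m: "m \<in> {x, r0 x, r2 x, r0 (r2 x)}" unfolding m_def by (intro Min_in) auto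
    have le: "m \<le> y" if "y \<in> {x, r0 x, r2 x, r0 (r2 x)}" for y unfolding m_def using that by (intro Min_le) auto
    have mH: "m \<in> H" using m x H(2) by auto
    then have mN: "m < N" using HN by simp
    have "r0 m \<in> {x, r0 x, r2 x, r0 (r2 x)}" "r2 m \<in> {x, r0 x, r2 x, r0 (r2 x)}"
      "r0 (r2 m) \<in> {x, r0 x, r2 x, r0 (r2 x)}"
      using m xN comm(1)[OF xN] comm(1)[of "r0 x"] by auto
    then have "m \<le> r0 m" "m \<le> r2 m" "m \<le> r0 (r2 m)" using le by auto
    moreover have "r0 m \<noteq> m" "r2 m \<noteq> m" "r0 (r2 m) \<noteq> m" using mN comm(2)[OF mN] by auto
    ultimately have "m \<in> A" using mH by (auto simp: A_def)
    then show ?thesis using m by auto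
  qed
  have fin: "finite H" using H(1) by (rule finite_subset) simp
  have inj: "inj_on r0 {..<N}" "inj_on r2 {..<N}" by (metis inj_onI inv(2) lessThan_iff, metis inj_onI inv(8) lessThan_iff)
  have "A \<inter> r0 ` A = {}"
  proof (rule ccontr)
    assume "A \<inter> r0 ` A \<noteq> {}"
    then obtain x where "x \<in> A" "r0 x \<in> A" by auto
    then show False using HN[of x] by (auto simp: A_def)
  qed
  then have "card G = 2 * card A"
    unfolding G_def using AH fin inj(1) H(1) by (intro card_Un_image) (auto intro: finite_subset inj_on_subset)
  moreover have "G \<inter> r2 ` G = {}"
  proof (rule ccontr)
    assume "G \<inter> r2 ` G \<noteq> {}"
    then obtain x where x: "x \<in> G" "r2 x \<in> G" by auto
    then have xN: "x < N" using GH HN by auto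
    have n: "\<not> (y \<in> A \<and> r2 y \<in> A)" "\<not> (y \<in> A \<and> r0 (r2 y) \<in> A)" if "y < N" for y
    proof -
      show "\<not> (y \<in> A \<and> r2 y \<in> A)" using that by (auto simp: A_def)
      have "r0 (r2 (r0 (r2 y))) = y" using that comm(1)[of "r2 y"] comm(1)[of y] by simp
      then show "\<not> (y \<in> A \<and> r0 (r2 y) \<in> A)" by (auto simp: A_def)
    qed
    consider "x \<in> A" | "r0 x \<in> A" using x(1) AH HN by (auto simp: G_def)
    moreover consider "r2 x \<in> A" | "r0 (r2 x) \<in> A" using x(2) AH HN by (auto simp: G_def)
    ultimately show False
      using n[of x] n[of "r0 x"] xN comm(1)[OF xN] comm(1)[of "r0 x"] by (metis inv(1,2))
  qed
  then have "card (G \<union> r2 ` G) = 2 * card G"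
    using GH fin inj(2) H(1) by (intro card_Un_image) (auto intro: finite_subset inj_on_subset)
  moreover have "G \<union> r2 ` G = H"
  proof
    show "G \<union> r2 ` G \<subseteq> H" using GH H(2) by auto
    show "H \<subseteq> G \<union> r2 ` G"
    proof
      fix x assume x: "x \<in> H"
      then have xN: "x < N" using HN by simp
      have g: "y \<in> G" if "y < N" "y \<in> A \<or> r0 y \<in> A" for y
        using that unfolding G_def by (metis UnI1 UnI2 imageI inv(2))
      show "x \<in> G \<union> r2 ` G"
        using cov[OF x] g[OF xN] g[of "r2 x"] xN by (metis UnI1 UnI2 imageI inv(7,8))
    qed
  qed
  ultimately have "4 * card A = card H" by simp
  then show thesis using that AH cov by blast
qed

lemma (in simple_gem) ex_code:
  assumes n: "card (vertices (N, r0, r1, r2)) = n" and h: "euler_genus (N, r0, r1, r2) = int h"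
  shows "\<exists>lsT T OT lsD D OD A B W k ks. coded_gem N r0 r1 r2 lsT T OT lsD D OD A B W k ks \<and>
    length W = 12 * (n + h) \<and> length ks = h \<and> set ks \<subseteq> {..<h}"
proof -
  interpret P: tree_growth N r1 r2 r0 "{..<N}" 0
  proof
    fix Y assume Y: "Y \<subseteq> {..<N}" "Y \<noteq> {}" "\<And>x. x \<in> Y \<Longrightarrow> r1 x \<in> Y \<and> r2 x \<in> Y"
      "\<And>x. x \<in> Y \<Longrightarrow> x \<in> {..<N} \<Longrightarrow> r0 x \<in> Y"
    then obtain y where y: "y \<in> Y" "y < N" by auto
    have "z \<in> Y" if "z < N" for z
    proof (rule reach_closed)
      show "(y, z) \<in> (step_rel N [r0, r1, r2])\<^sup>*" using is_map y that by auto
    qed (use Y y in auto)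
    then show "Y = {..<N}" using Y by auto
  next
    fix x assume "x < N"
    then show "r2 (r0 x) = r0 (r2 x)" "r2 (r0 x) \<noteq> x" using comm[of x] by simp_all
  qed (use fpf pos in auto)
  obtain lsT T OT where T: "tour (\<lambda>x. if x \<in> T then r0 x else r2 x) r1 lsT" "fst (hd lsT) = 0"
    "set (flat lsT) = {..<N}" "T \<subseteq> {..<N}" "\<forall>x\<in>T. r2 x \<in> T" "\<forall>x\<in>T. r0 x \<in> T"
    "\<forall>x\<in>T. x \<in> OT \<or> r2 x \<in> OT"
    "nested r2 OT (filter (\<lambda>x. x \<in> T) (flat lsT))" "card T + 4 = 4 * card (orbits N [r1, r2])"
    by (rule P.spanning_tour) (rule that; assumption)
  have T0: "r0 x \<in> T \<longleftrightarrow> x \<in> T" "r2 x \<in> T \<longleftrightarrow> x \<in> T" if "x < N" for x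
    using that T(5,6) inv(2,8) by metis+
  interpret Q: tree_growth N r1 r0 r2 "{..<N} - T" 0
  proof
    fix Y assume Y: "Y \<subseteq> {..<N}" "Y \<noteq> {}" "\<And>x. x \<in> Y \<Longrightarrow> r1 x \<in> Y \<and> r0 x \<in> Y"
      "\<And>x. x \<in> Y \<Longrightarrow> x \<in> {..<N} - T \<Longrightarrow> r2 x \<in> Y"
    then obtain y where y: "y \<in> Y" "y < N" by auto
    have "r0 x \<in> Y \<longleftrightarrow> x \<in> Y" "r1 x \<in> Y \<longleftrightarrow> x \<in> Y" if "x < N" for x
      using that Y(3) inv(2,5) by metis+
    moreover have "r2 x \<in> Y \<longleftrightarrow> x \<in> Y" if "x < N" "x \<notin> T" for x
      using that Y(4)[of x] Y(4)[of "r2 x"] T0 by auto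
    ultimately have *: "((if x \<in> T then r0 x else r2 x) \<in> Y \<longleftrightarrow> x \<in> Y) \<and> (r1 x \<in> Y \<longleftrightarrow> x \<in> Y)"
      if "x \<in> set (flat lsT)" for x using that T(3) by auto
    have "z \<in> Y" if "z < N" for z
      using tour_invariant[OF T(1) *, of y z] y that T(3) by auto
    then show "Y = {..<N}" using Y by auto
  next
    fix x assume "x < N"
    then show "r0 (r2 x) = r2 (r0 x)" "r0 (r2 x) \<noteq> x" using comm[of x] by simp_all
  qed (use fpf pos T0 in auto)
  obtain lsD D OD where D: "tour (\<lambda>x. if x \<in> D then r2 x else r0 x) r1 lsD" "fst (hd lsD) = 0"
    "set (flat lsD) = {..<N}" "D \<subseteq> {..<N} - T" "\<forall>x\<in>D. r0 x \<in> D" "\<forall>x\<in>D. r2 x \<in> D"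
    "\<forall>x\<in>D. x \<in> OD \<or> r0 x \<in> OD"
    "nested r0 OD (filter (\<lambda>x. x \<in> D) (flat lsD))" "card D + 4 = 4 * card (orbits N [r1, r0])"
    by (rule Q.spanning_tour) (rule that; assumption)
  have D0: "r0 x \<in> D \<longleftrightarrow> x \<in> D" "r2 x \<in> D \<longleftrightarrow> x \<in> D" if "x < N" for x
    using that D(5,6) inv(2,8) by metis+
  define H where "H = {..<N} - T - D"
  have "\<And>x. x \<in> H \<Longrightarrow> r0 x \<in> H \<and> r2 x \<in> H" using T0 D0 by (auto simp: H_def)
  then obtain A where A: "A \<subseteq> H" "4 * card A = card H"
    "\<And>x. x \<in> H \<Longrightarrow> x \<in> A \<or> r0 x \<in> A \<or> r2 x \<in> A \<or> r0 (r2 x) \<in> A"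
    using edge_transversal[of H] by (auto simp: H_def)
  have cH: "card H + card T + card D = N"
  proof -
    have "card H = card ({..<N} - T) - card D"
      unfolding H_def using D(4) by (intro card_Diff_subset) (auto intro: finite_subset)
    moreover have "card ({..<N} - T) = N - card T"
      using T(4) card_Diff_subset[of T "{..<N}"] by (auto intro: finite_subset)
    moreover have "card D \<le> card ({..<N} - T)" using D(4) by (intro card_mono) auto
    moreover have "card T \<le> N" using T(4) card_mono[of "{..<N}" T] by auto
    ultimately show ?thesis by linarith
  qed
  have cA: "card A = h"
  proof -
    define e f where "e = card (edges (N, r0, r1, r2))" and "f = card (faces (N, r0, r1, r2))"
    have "step_rel N [r1, r0] = step_rel N [r0, r1]" by (auto simp: step_rel_def)
    then have "card D + 4 = 4 * f" using D(9) by (simp add: f_def orbits_def)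
    moreover have "card T + 4 = 4 * n" using T(9) n by simp
    moreover have "N = 4 * e" using edges_card by (simp add: e_def)
    moreover have "int (n + h) = 2 + int e - int f"
      using h n unfolding euler_genus_def e_def f_def by simp
    ultimately show ?thesis using cH A(2) by linarith
  qed
  define B where "B = r0 ` A"
  have AN: "A \<subseteq> {..<N}" using A(1) by (auto simp: H_def)
  have BN: "B \<subseteq> {..<N}" using AN by (auto simp: B_def)
  have "inj_on r0 A" using AN by (metis inj_onI inv(2) lessThan_iff subsetD)
  then have cB: "card B = h" using cA by (simp add: B_def card_image)
  let ?FA = "filter (\<lambda>x. x \<in> A) (flat lsT)" and ?FB = "filter (\<lambda>x. x \<in> B) (flat lsT)"
  have dT: "distinct (flat lsT)" using tourD(2)[OF T(1)] .
  have sets: "set ?FA = A" "set ?FB = B" using AN BN T(3) by auto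
  have lFA: "length ?FA = h" using distinct_card[of ?FA] dT sets(1) cA by simp
  have lFB: "length ?FB = h" using distinct_card[of ?FB] dT sets(2) cB by simp
  have "\<forall>x\<in>A. \<exists>i. i < h \<and> ?FB ! i = r0 x"
    using sets(2) lFB by (metis B_def imageI in_set_conv_nth)
  then obtain idx where idx: "\<And>x. x \<in> A \<Longrightarrow> idx x < h \<and> ?FB ! idx x = r0 x" by metis
  define ks where "ks = map idx ?FA"
  define W where "W = map (\<lambda>x. Some (x \<in> T, x \<in> OT, x \<in> D, x \<in> OD, x \<in> A, x \<in> B)) (flat lsT) @
      replicate (12 * (n + h) - N) None"
  have lT: "length (flat lsT) = N" using distinct_card[OF dT] T(3) by simp
  have "coded_gem N r0 r1 r2 lsT T OT lsD D OD A B W (12 * (n + h) - N) ks"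
  proof
    show "map r0 ?FA = map ((!) ?FB) ks" using idx sets(1) by (auto simp: ks_def)
    show "set ks \<subseteq> {..<length ?FB}" using idx sets(1) lFB by (auto simp: ks_def)
    show "x \<in> A \<or> r0 x \<in> A \<or> r2 x \<in> A \<or> r0 (r2 x) \<in> A" if "x < N" "x \<notin> T" "x \<notin> D" for x
      using A(3)[of x] that by (simp add: H_def)
  qed (use T D in \<open>auto simp: W_def\<close>)
  moreover have "length W = 12 * (n + h)" using flags_bound[OF n h] lT by (simp add: W_def)
  moreover have "length ks = h" "set ks \<subseteq> {..<h}" using lFA idx sets(1) by (auto simp: ks_def)
  ultimately show ?thesis by (intro exI conjI)
qed

lemma map_iso_trans:
  assumes "map_iso M M'" "map_iso M' M''"
  shows "map_iso M M''"
proof -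
  obtain N r0 r1 r2 where M: "M = (N, r0, r1, r2)" by (cases M)
  obtain N' s0 s1 s2 where M': "M' = (N', s0, s1, s2)" by (cases M')
  obtain N'' t0 t1 t2 where M'': "M'' = (N'', t0, t1, t2)" by (cases M'')
  obtain f where f: "bij_betw f {..<N} {..<N}" "N = N'"
    "\<forall>x<N. f (r0 x) = s0 (f x) \<and> f (r1 x) = s1 (f x) \<and> f (r2 x) = s2 (f x)"
    using assms(1) by (auto simp: M M')
  obtain g where g: "bij_betw g {..<N'} {..<N'}" "N' = N''"
    "\<forall>x<N'. g (s0 x) = t0 (g x) \<and> g (s1 x) = t1 (g x) \<and> g (s2 x) = t2 (g x)"
    using assms(2) by (auto simp: M' M'')
  have "f x < N" if "x < N" for x using bij_betwE[OF f(1)] that by auto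
  then have "\<forall>x<N. (g \<circ> f) (r0 x) = t0 ((g \<circ> f) x) \<and> (g \<circ> f) (r1 x) = t1 ((g \<circ> f) x) \<and> (g \<circ> f) (r2 x) = t2 ((g \<circ> f) x)"
    using f g by auto
  moreover have "bij_betw (g \<circ> f) {..<N} {..<N}" using f g bij_betw_trans by blast
  ultimately show ?thesis using f(2) g(2) unfolding M M'' by auto
qed

lemma card_quotient_le:
  assumes "finite C" and code: "\<And>x. x \<in> X \<Longrightarrow> \<exists>c\<in>C. P x c"
    and eq: "\<And>x y c. x \<in> X \<Longrightarrow> y \<in> X \<Longrightarrow> P x c \<Longrightarrow> P y c \<Longrightarrow> R `` {x} = R `` {y}"
  shows "card (X // R) \<le> card C"
proof -
  define g where "g c = R `` {SOME x. x \<in> X \<and> P x c}" for c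
  have "X // R \<subseteq> g ` C"
  proof
    fix q assume "q \<in> X // R"
    then obtain x where x: "x \<in> X" "q = R `` {x}" by (auto simp: quotient_def)
    obtain c where c: "c \<in> C" "P x c" using code[OF x(1)] by blast
    have "(SOME x. x \<in> X \<and> P x c) \<in> X \<and> P (SOME x. x \<in> X \<and> P x c) c"
      using someI[of "\<lambda>x. x \<in> X \<and> P x c" x] x c by blast
    then have "g c = q" using eq x c unfolding g_def by blast
    then show "q \<in> g ` C" using c by blast
  qed
  then show ?thesis using surj_card_le[OF assms(1)] by blast
qed

lemma num_simple_maps_le:
  assumes "3 \<le> n"
  shows "num_simple_maps n orient h \<le> card (UNIV :: label option set) ^ (12 * (n + h)) * h ^ h"
proof -
  define C where "C = {W :: label option list. set W \<subseteq> UNIV \<and> length W = 12 * (n + h)} \<times>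
    {ks. set ks \<subseteq> {..<h} \<and> length ks = h}"
  define P where "P M c \<longleftrightarrow> (case M of (N, r0, r1, r2) \<Rightarrow>
    \<exists>lsT T OT lsD D OD A B k. coded_gem N r0 r1 r2 lsT T OT lsD D OD A B (fst c) k (snd c))" for M c
  have iso: "map_iso M M'" if "P M c" "P M' c" for M M' c
  proof -
    obtain N r0 r1 r2 where M: "M = (N, r0, r1, r2)" by (cases M)
    obtain N' s0 s1 s2 where M': "M' = (N', s0, s1, s2)" by (cases M')
    from that show ?thesis
      unfolding P_def M M' prod.case by (elim exE) (rule coded_gem_iso)
  qed
  have fin: "finite C" unfolding C_def
    using finite_lists_length_eq[of "UNIV :: label option set"] finite_lists_length_eq[of "{..<h}"]
    by (intro finite_cartesian_product) auto
  have "card (simple_maps_in n orient h // {(M, M'). map_iso M M'}) \<le> card C"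
  proof (rule card_quotient_le[where P = P])
    fix M assume M: "M \<in> simple_maps_in n orient h"
    obtain N r0 r1 r2 where Meq: "M = (N, r0, r1, r2)" by (cases M)
    interpret simple_gem N r0 r1 r2
      using M assms by unfold_locales (auto simp: simple_maps_in_def Meq)
    have "\<exists>lsT T OT lsD D OD A B W k ks. coded_gem N r0 r1 r2 lsT T OT lsD D OD A B W k ks \<and>
      length W = 12 * (n + h) \<and> length ks = h \<and> set ks \<subseteq> {..<h}"
      using M by (intro ex_code) (auto simp: simple_maps_in_def Meq)
    then show "\<exists>c\<in>C. P M c" unfolding P_def C_def Meq by fastforce
  next
    fix M M' c assume "P M c" "P M' c"
    then show "{(M, M'). map_iso M M'} `` {M} = {(M, M'). map_iso M M'} `` {M'}"
      using iso map_iso_trans by blast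
  qed (rule fin)
  also have "card C = card (UNIV :: label option set) ^ (12 * (n + h)) * h ^ h"
    unfolding C_def card_cartesian_product
    by (subst card_lists_length_eq, simp)+ simp
  finally show ?thesis unfolding num_simple_maps_def .
qed

theorem theorem7:
  shows "\<exists>(c::real) (n0::nat). \<forall>n\<ge>n0. \<forall>h::nat. \<forall>orient.
           is_surface orient h \<longrightarrow>
           real (num_simple_maps n orient h) \<le> c ^ (n + h) * real h ^ h"
proof (intro exI allI impI)
  fix n h :: nat and orient
  assume "3 \<le> n"
  then have "real (num_simple_maps n orient h) \<le> real (card (UNIV :: label option set) ^ (12 * (n + h)) * h ^ h)"
    using num_simple_maps_le by (simp only: of_nat_le_iff)
  also have "\<dots> = (real (card (UNIV :: label option set)) ^ 12) ^ (n + h) * real h ^ h"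
    by (simp only: of_nat_mult of_nat_power power_mult)
  finally show "real (num_simple_maps n orient h) \<le> (real (card (UNIV :: label option set)) ^ 12) ^ (n + h) * real h ^ h" .
qed

end
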